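(* Let $X$ and $Y$ be filtered spaces of the same stratified dimension $n$, and let $\bar p$ be a perversity. If $f:X\to Y$ is a stratum-preserving homotopy equivalence with (stratum-preserving homotopy) inverse $g:Y\to X$, and $f(X_i-X_{i-1})\subset Y_i-Y_{i-1}$ and $g(Y_i-Y_{i-1})\subset X_i-X_{i-1}$ for each $i$, then $f$ and $g$ induce isomorphisms of intersection homology $f_*:IH^{\bar p}_i(X)\to IH^{\bar p}_i(Y)$ and $g_*:IH^{\bar p}_i(Y)\to IH^{\bar p}_i(X)$.
   Context: A filtered space is a space $X$ with closed subspaces $\emptyset=X_{-1}\subset X_0\subset\cdots\subset X_n=X$ (equalities allowed); $n$ is its stratified dimension and the sets $X_i-X_{i-1}$ are its strata. $X\times I$ ($I=[0,1]$) is filtered by $\{X_i\times I\}$. A map $f:X\to Y$ of filtered spaces is stratum-preserving if the image of each component of a stratum of $X$ lies in a stratum of $Y$; a homotopy $X\times I\to Y$ is stratum-preserving if it is so as a map from $X\times I$ filtered by $\{X_i\times I\}$. $f$ is a stratum-preserving homotopy equivalence with inverse $g$ if $g:Y\to X$ is stratum-preserving and $fg$, $gf$ are stratum-preserving homotopic to the identities. A perversity $\bar p$ is a sequence of integers $\bar p(0),\bar p(1),\ldots$ with $\bar p(i)\le\bar p(i+1)\le\bar p(i)+1$ and $\bar p(0)=\bar p(1)=\bar p(2)=0$. A singular simplex $\sigma:\Delta^i\to X$ is $\bar p$-allowable if for each $k$, $\sigma^{-1}(X_{n-k}-X_{n-k-1})$ lies in the $(i-k+\bar p(k))$-skeleton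 of $\Delta^i$. A singular $i$-chain is $\bar p$-allowable if it and its boundary are linear combinations of $\bar p$-allowable simplices; $IH^{\bar p}_*(X)$ is the homology of the complex $IC^{\bar p}_*(X)$ of $\bar p$-allowable singular chains. *)

theory Defs
  imports "HOL-Homology.Homology"
begin

section \<open>Filtered spaces and stratum-preserving maps\<close>

text \<open>Only the values \<open>filt X i\<close> for \<open>-1 \<le> i \<le> fdim X\<close> are meaningful.\<close>

record 'a filtered =
  ftop :: "'a topology"
  fdim :: nat
  filt :: "int \<Rightarrow> 'a set"

definition filtered_space :: "'a filtered \<Rightarrow> bool" where
  "filtered_space X \<longleftrightarrow>
     filt X (-1) = {} \<and>
     filt X (int (fdim X)) = topspace (ftop X) \<and>
     (\<forall>i \<in> {-1..int (fdim X)}. closedin (ftop X) (filt X i)) \<and>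
     (\<forall>i \<in> {0..int (fdim X)}. filt X (i - 1) \<subseteq> filt X i)"

definition stratum :: "'a filtered \<Rightarrow> int \<Rightarrow> 'a set" where
  "stratum X i = filt X i - filt X (i - 1)"

definition stratum_preserving :: "'a filtered \<Rightarrow> 'b filtered \<Rightarrow> ('a \<Rightarrow> 'b) \<Rightarrow> bool" where
  "stratum_preserving X Y f \<longleftrightarrow>
     continuous_map (ftop X) (ftop Y) f \<and>
     (\<forall>i \<in> {0..int (fdim X)}.
        \<forall>C \<in> connected_components_of (subtopology (ftop X) (stratum X i)).
          \<exists>j \<in> {0..int (fdim Y)}. f ` C \<subseteq> stratum Y j)"

definition filtered_cylinder :: "'a filtered \<Rightarrow> ('a \<times> real) filtered" where
  "filtered_cylinder X =
     \<lparr> ftop = prod_topology (ftop X) (top_of_set {0..1}),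
       fdim = fdim X,
       filt = (\<lambda>i. filt X i \<times> {0..1}) \<rparr>"

definition stratum_preserving_homotopic ::
    "'a filtered \<Rightarrow> 'b filtered \<Rightarrow> ('a \<Rightarrow> 'b) \<Rightarrow> ('a \<Rightarrow> 'b) \<Rightarrow> bool" where
  "stratum_preserving_homotopic X Y f g \<longleftrightarrow>
     (\<exists>H. stratum_preserving (filtered_cylinder X) Y H \<and>
          (\<forall>x \<in> topspace (ftop X). H (x, 0) = f x \<and> H (x, 1) = g x))"

definition stratum_preserving_homotopy_equivalence ::
    "'a filtered \<Rightarrow> 'b filtered \<Rightarrow> ('a \<Rightarrow> 'b) \<Rightarrow> ('b \<Rightarrow> 'a) \<Rightarrow> bool" where
  "stratum_preserving_homotopy_equivalence X Y f g \<longleftrightarrow>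
     stratum_preserving X Y f \<and> stratum_preserving Y X g \<and>
     stratum_preserving_homotopic Y Y (f \<circ> g) id \<and>
     stratum_preserving_homotopic X X (g \<circ> f) id"


section \<open>Intersection homology\<close>

definition perversity :: "(nat \<Rightarrow> int) \<Rightarrow> bool" where
  "perversity p \<longleftrightarrow>
     p 0 = 0 \<and> p 1 = 0 \<and> p 2 = 0 \<and> (\<forall>i. p i \<le> p (Suc i) \<and> p (Suc i) \<le> p i + 1)"

text \<open>The union of the faces of dimension at most \<open>m\<close> of the standard \<open>i\<close>-simplex; the face
  spanned by the vertices in \<open>V\<close> has dimension \<open>card V - 1\<close>. It is empty for \<open>m < 0\<close>.\<close>

definition simplex_skeleton :: "nat \<Rightarrow> int \<Rightarrow> (nat \<Rightarrow> real) set" where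
  "simplex_skeleton i m =
     (\<Union>V \<in> {V. V \<subseteq> {..i} \<and> V \<noteq> {} \<and> int (card V) - 1 \<le> m}.
        {x \<in> standard_simplex i. \<forall>j. j \<notin> V \<longrightarrow> x j = 0})"

definition allowable_simplex ::
    "(nat \<Rightarrow> int) \<Rightarrow> 'a filtered \<Rightarrow> nat \<Rightarrow> ((nat \<Rightarrow> real) \<Rightarrow> 'a) \<Rightarrow> bool" where
  "allowable_simplex p X i \<sigma> \<longleftrightarrow>
     singular_simplex i (ftop X) \<sigma> \<and>
     (\<forall>k \<in> {0..fdim X}.
        {x \<in> standard_simplex i. \<sigma> x \<in> stratum X (int (fdim X) - int k)}
          \<subseteq> simplex_skeleton i (int i - int k + p k))"

text \<open>The group of \<open>p\<close>-allowable \<open>i\<close>-chains, with integer coefficients. For \<open>i = 0\<close> the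
  boundary is \<open>0\<close>, so the truncated \<open>i - 1\<close> is harmless.\<close>

definition IC :: "(nat \<Rightarrow> int) \<Rightarrow> 'a filtered \<Rightarrow> nat \<Rightarrow> 'a chain set" where
  "IC p X i =
     {c. Poly_Mapping.keys c \<subseteq> Collect (allowable_simplex p X i) \<and>
         Poly_Mapping.keys (chain_boundary i c) \<subseteq> Collect (allowable_simplex p X (i - 1))}"

definition IC_cycles :: "(nat \<Rightarrow> int) \<Rightarrow> 'a filtered \<Rightarrow> nat \<Rightarrow> 'a chain set" where
  "IC_cycles p X i = {c \<in> IC p X i. chain_boundary i c = 0}"

definition IC_boundaries :: "(nat \<Rightarrow> int) \<Rightarrow> 'a filtered \<Rightarrow> nat \<Rightarrow> 'a chain set" where
  "IC_boundaries p X i = chain_boundary (Suc i) ` IC p X (Suc i)"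

definition IC_cycle_group :: "(nat \<Rightarrow> int) \<Rightarrow> 'a filtered \<Rightarrow> nat \<Rightarrow> 'a chain monoid" where
  "IC_cycle_group p X i = subgroup_generated (chain_group i (ftop X)) (IC_cycles p X i)"

definition IH :: "(nat \<Rightarrow> int) \<Rightarrow> 'a filtered \<Rightarrow> nat \<Rightarrow> 'a chain set monoid" where
  "IH p X i = IC_cycle_group p X i Mod IC_boundaries p X i"

text \<open>The map \<open>[z] \<mapsto> [f\<^sub># z]\<close>; it is well defined whenever \<open>chain_map j f\<close> maps \<open>IC p X j\<close>
  into \<open>IC p Y j\<close> for all \<open>j\<close>.\<close>

definition IH_induced ::
    "(nat \<Rightarrow> int) \<Rightarrow> 'a filtered \<Rightarrow> 'b filtered \<Rightarrow> nat \<Rightarrow> ('a \<Rightarrow> 'b)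
       \<Rightarrow> 'a chain set \<Rightarrow> 'b chain set" where
  "IH_induced p X Y i f =
     (\<lambda>C. the_elem ((\<lambda>z. IC_boundaries p Y i #>\<^bsub>IC_cycle_group p Y i\<^esub> chain_map i f z) ` C))"

text \<open>The generated subgroup and the quotient used above are the expected ones.\<close>

lemma IC_singular_chain: "c \<in> IC p X i \<Longrightarrow> singular_chain i (ftop X) c"
  by (auto simp: IC_def singular_chain_def allowable_simplex_def)

lemma zero_in_IC: "0 \<in> IC p X i"
  by (simp add: IC_def)

lemma IC_diff:
  assumes "a \<in> IC p X i" "b \<in> IC p X i"
  shows "a - b \<in> IC p X i"
  using assms keys_diff[of a b] keys_diff[of "chain_boundary i a" "chain_boundary i b"]
  unfolding IC_def by (auto simp: chain_boundary_diff)

lemma subgroup_chain_groupI: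
  assumes "S \<subseteq> singular_chain_set i X" "0 \<in> S" "\<And>a b. \<lbrakk>a \<in> S; b \<in> S\<rbrakk> \<Longrightarrow> a - b \<in> S"
  shows "subgroup S (chain_group i X)"
proof (rule group.subgroupI)
  show "inv\<^bsub>chain_group i X\<^esub> a \<in> S" if "a \<in> S" for a
  proof -
    have "inv\<^bsub>chain_group i X\<^esub> a = 0 - a"
      using that assms(1) by (subst m_inv_chain_group) (auto simp: singular_chain_def subset_iff)
    then show ?thesis using assms(2,3) that by metis
  qed
  show "a \<otimes>\<^bsub>chain_group i X\<^esub> b \<in> S" if "a \<in> S" "b \<in> S" for a b
    using assms(3)[OF that(1) assms(3)[OF assms(2) that(2)]] by simp
qed (use assms in auto)

lemma subgroup_IC_cycles: "subgroup (IC_cycles p X i) (chain_group i (ftop X))"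
  by (rule subgroup_chain_groupI)
     (auto simp: IC_cycles_def IC_singular_chain zero_in_IC IC_diff chain_boundary_diff)

lemma carrier_IC_cycle_group: "carrier (IC_cycle_group p X i) = IC_cycles p X i"
  unfolding IC_cycle_group_def
  by (rule subgroup.carrier_subgroup_generated_subgroup [OF subgroup_IC_cycles])

lemma IC_boundaries_subset: "IC_boundaries p X i \<subseteq> IC_cycles p X i"
proof
  fix c assume "c \<in> IC_boundaries p X i"
  then obtain d where d: "d \<in> IC p X (Suc i)" and c: "c = chain_boundary (Suc i) d"
    by (auto simp: IC_boundaries_def)
  have "chain_boundary i c = 0"
    unfolding c using chain_boundary_boundary[OF IC_singular_chain[OF d]] by simp
  then show "c \<in> IC_cycles p X i"
    using d by (simp add: IC_cycles_def IC_def c)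
qed

lemma normal_IC_boundaries: "IC_boundaries p X i \<lhd> IC_cycle_group p X i"
proof -
  have "subgroup (IC_boundaries p X i) (chain_group i (ftop X))"
  proof (rule subgroup_chain_groupI)
    show "IC_boundaries p X i \<subseteq> singular_chain_set i (ftop X)"
      using IC_boundaries_subset[of p X i] by (auto simp: IC_cycles_def IC_singular_chain)
    show "0 \<in> IC_boundaries p X i"
      unfolding IC_boundaries_def using zero_in_IC[of p X "Suc i"]
      by (intro image_eqI[of _ _ 0]) auto
    show "a - b \<in> IC_boundaries p X i"
      if ab: "a \<in> IC_boundaries p X i" "b \<in> IC_boundaries p X i" for a b
    proof -
      from ab obtain a' b' where "a' \<in> IC p X (Suc i)" "b' \<in> IC p X (Suc i)"
        and "a = chain_boundary (Suc i) a'" "b = chain_boundary (Suc i) b'"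
        unfolding IC_boundaries_def by blast
      then show ?thesis
        unfolding IC_boundaries_def
        by (intro image_eqI[of _ _ "a' - b'"]) (auto simp: chain_boundary_diff IC_diff)
    qed
  qed
  then have "subgroup (IC_boundaries p X i) (IC_cycle_group p X i)"
    unfolding IC_cycle_group_def
    by (metis group.subgroup_of_subgroup_generated group_chain_group IC_boundaries_subset)
  moreover have "comm_group (IC_cycle_group p X i)"
    unfolding IC_cycle_group_def
    by (intro group.abelian_subgroup_generated group_chain_group abelian_chain_group)
  ultimately show ?thesis
    by (simp add: comm_group.subgroup_imp_normal)
qed

end

theory Submission
  imports Defs
begin

text \<open>A stratum-preserving homotopy \<open>H\<close> that ends at the identity maps each \<open>{x} \<times> I\<close> into the
  stratum of \<open>x\<close>, since \<open>{x} \<times> I\<close> is connected and \<open>H(x, 1) = x\<close>. The simplices of the prism over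
  a simplex \<open>\<sigma>\<close> therefore meet a stratum exactly in the preimage, under a degeneracy of the standard
  simplex, of the set where \<open>\<sigma>\<close> meets it. Degeneracies pull the \<open>m\<close>-skeleton back into the
  \<open>(m + 1)\<close>-skeleton, which is what allowability loses in passing from dimension \<open>i\<close> to \<open>i + 1\<close>.
  Hence the classical prism operator is a chain homotopy on allowable chains.\<close>

section \<open>The prism operator\<close>

text \<open>The j-th degeneracy in barycentric coordinates: the affine map induced by the monotone
  surjection of vertices that takes the value \<open>j\<close> twice.\<close>

definition collapse :: "nat \<Rightarrow> (nat \<Rightarrow> real) \<Rightarrow> nat \<Rightarrow> real" where
  "collapse j x = (\<lambda>i. if i < j then x i else if i = j then x j + x (Suc j) else x (Suc i))"

text \<open>On a standard simplex this is the mass carried by the vertices from \<open>m\<close>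
  onwards. Writing it as a complement avoids any reference to the dimension, so that one formula
  serves all simplices.\<close>

definition tail_weight :: "nat \<Rightarrow> (nat \<Rightarrow> real) \<Rightarrow> real" where
  "tail_weight m x = 1 - (\<Sum>i<m. x i)"

text \<open>\<open>x \<mapsto> (collapse j x, tail_weight (Suc j) x)\<close> is the affine simplex of
  \<open>\<Delta>\<^sup>q \<times> I\<close> with vertices \<open>(e\<^sub>0,0), \<dots>, (e\<^sub>j,0), (e\<^sub>j,1), \<dots>, (e\<^sub>q,1)\<close>.\<close>

definition prism_simplex ::
    "nat \<Rightarrow> ('a \<times> real \<Rightarrow> 'b) \<Rightarrow> nat \<Rightarrow> ((nat \<Rightarrow> real) \<Rightarrow> 'a) \<Rightarrow> (nat \<Rightarrow> real) \<Rightarrow> 'b" where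
  "prism_simplex q H j \<sigma> =
     restrict (\<lambda>x. H (\<sigma> (collapse j x), tail_weight (Suc j) x)) (standard_simplex (Suc q))"

definition prism :: "nat \<Rightarrow> ('a \<times> real \<Rightarrow> 'b) \<Rightarrow> 'a chain \<Rightarrow> 'b chain" where
  "prism q H =
     frag_extend (\<lambda>\<sigma>. \<Sum>j\<le>q. frag_cmul ((-1) ^ j) (frag_of (prism_simplex q H j \<sigma>)))"

lemma prism_0 [simp]: "prism q H 0 = 0"
  by (simp add: prism_def)

lemma prism_diff: "prism q H (a - b) = prism q H a - prism q H b"
  by (simp add: prism_def frag_extend_diff)

lemma prism_cmul: "prism q H (frag_cmul k c) = frag_cmul k (prism q H c)"
  by (simp add: prism_def frag_extend_cmul)

lemma prism_sum: "finite I \<Longrightarrow> prism q H (sum c I) = (\<Sum>i\<in>I. prism q H (c i))"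
  by (simp add: prism_def frag_extend_sum o_def)

lemma prism_of:
  "prism q H (frag_of \<sigma>) = (\<Sum>j\<le>q. frag_cmul ((-1) ^ j) (frag_of (prism_simplex q H j \<sigma>)))"
  by (simp add: prism_def)

lemma keys_prism:
  "Poly_Mapping.keys (prism q H c)
     \<subseteq> {prism_simplex q H j \<sigma> | j \<sigma>. j \<le> q \<and> \<sigma> \<in> Poly_Mapping.keys c}"
proof -
  have "Poly_Mapping.keys (\<Sum>j\<le>q. frag_cmul ((-1) ^ j) (frag_of (prism_simplex q H j \<sigma>)))
      \<subseteq> {prism_simplex q H j \<sigma> | j. j \<le> q}" for \<sigma>
    by (rule order_trans[OF keys_sum]) (auto dest: subsetD[OF keys_cmul])
  then show ?thesis
    unfolding prism_def using keys_frag_extend by fastforce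
qed

text \<open>The merged coordinates \<open>j\<close> and \<open>Suc j\<close> both lie in the
  summation range exactly because \<open>j < m\<close>, so merging them leaves the total
  unchanged.\<close>

lemma sum_collapse:
  assumes "j < m"
  shows "(\<Sum>i<m. collapse j x i) = (\<Sum>i<Suc m. x i)"
  using assms
proof (induction m)
  case (Suc m)
  show ?case
  proof (cases "j < m")
    case True
    then show ?thesis using Suc.IH by (simp add: collapse_def)
  next
    case False
    then have "j = m" using Suc.prems by simp
    then show ?thesis by (simp add: collapse_def)
  qed
qed simp

lemma collapse_in_standard_simplex:
  assumes x: "x \<in> standard_simplex (Suc q)" and "j \<le> q"
  shows "collapse j x \<in> standard_simplex q"
proof -
  have x0: "x i \<ge> 0" for i
    using x by (simp add: standard_simplex_def)
  have c0: "collapse j x i \<ge> 0" for i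
    using x0 by (auto simp: collapse_def)
  have s: "(\<Sum>i\<le>q. collapse j x i) = 1"
    using sum_collapse[of j "Suc q" x] \<open>j \<le> q\<close> x
    by (simp add: standard_simplex_def lessThan_Suc_atMost)
  have z: "collapse j x i = 0" if "i > q" for i
    using x that \<open>j \<le> q\<close> by (auto simp: collapse_def standard_simplex_def)
  have "collapse j x i \<le> 1" for i
    using z[of i] member_le_sum[of i "{..q}" "collapse j x"] c0 s by (cases "i \<le> q") auto
  then show ?thesis
    using c0 s z by (auto simp: standard_simplex_def)
qed

lemma tail_weight_0 [simp]: "tail_weight 0 x = 1"
  by (simp add: tail_weight_def)

lemma tail_weight_top: "x \<in> standard_simplex q \<Longrightarrow> tail_weight (Suc q) x = 0"
  by (simp add: tail_weight_def standard_simplex_def lessThan_Suc_atMost)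

lemma tail_weight_in_unit_interval:
  assumes x: "x \<in> standard_simplex q" and "m \<le> Suc q"
  shows "tail_weight m x \<in> {0..1}"
proof -
  have "(\<Sum>i<m. x i) \<le> (\<Sum>i\<le>q. x i)"
    by (rule sum_mono2) (use assms in \<open>auto simp: standard_simplex_def\<close>)
  moreover have "0 \<le> (\<Sum>i<m. x i)"
    by (rule sum_nonneg) (use x in \<open>auto simp: standard_simplex_def\<close>)
  ultimately show ?thesis
    using x by (simp add: tail_weight_def standard_simplex_def)
qed

section \<open>Faces of the prism simplices\<close>

lemma sum_simplical_face:
  "(\<Sum>i<m. simplical_face k x i) = (if k < m then \<Sum>i<m - 1. x i else \<Sum>i<m. x i)"
  for x :: "nat \<Rightarrow> real"
proof (induction m)
  case (Suc m)
  then show ?case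
    by (cases m) (auto simp: simplical_face_def less_Suc_eq)
qed simp

text \<open>A face map inserts a zero coordinate at \<open>k\<close>, so an initial segment reaching
  past \<open>k\<close> sees one coordinate of \<open>x\<close> fewer. In that case \<open>m\<close>
  is positive and \<open>m - 1\<close> is a true predecessor.\<close>

lemma tail_weight_simplical_face:
  "tail_weight m (simplical_face k x) = (if k < m then tail_weight (m - 1) x else tail_weight m x)"
  by (simp add: tail_weight_def sum_simplical_face)

text \<open>These are the cosimplicial identities between degeneracies and faces. They sort the
  faces of a prism simplex into the lower, diagonal and upper ones treated next.\<close>

lemma collapse_simplical_face:
  "k \<le> j \<Longrightarrow> collapse (Suc j) (simplical_face k x) = simplical_face k (collapse j x)"
  "k = j \<or> k = Suc j \<Longrightarrow> collapse j (simplical_face k x) = x"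
  "j < k \<Longrightarrow> collapse j (simplical_face (Suc k) x) = simplical_face k (collapse j x)"
  by (force simp: collapse_def simplical_face_def fun_eq_iff)+

text \<open>The deleted vertex is \<open>(e_k, 0)\<close>, which precedes the jump from level 0 to
  level 1; hence the jump moves from \<open>Suc j\<close> down to \<open>j\<close>.\<close>

lemma singular_face_prism_simplex_lower:
  assumes "k \<le> j" "j < q"
  shows "singular_face (Suc q) k (prism_simplex q H (Suc j) \<sigma>)
       = prism_simplex (q - 1) H j (singular_face q k \<sigma>)"
  using assms
  by (auto simp: singular_face_def prism_simplex_def fun_eq_iff collapse_simplical_face
      tail_weight_simplical_face simplical_face_in_standard_simplex collapse_in_standard_simplex)

text \<open>Deleting either vertex over \<open>e_j\<close> leaves a wall that depends on
  \<open>k\<close> only. So neighbouring prism simplices share a wall, and these walls will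
  cancel.\<close>

lemma singular_face_prism_simplex_diagonal:
  assumes "j \<le> q" "k = j \<or> k = Suc j"
  shows "singular_face (Suc q) k (prism_simplex q H j \<sigma>)
       = restrict (\<lambda>x. H (\<sigma> x, tail_weight k x)) (standard_simplex q)"
  using assms
  by (auto simp: singular_face_def prism_simplex_def fun_eq_iff collapse_simplical_face
      tail_weight_simplical_face simplical_face_in_standard_simplex)

text \<open>Beyond the jump the vertex \<open>(e_k, 1)\<close> has position \<open>Suc k\<close> in
  the prism simplex; deleting it does not move the jump.\<close>

lemma singular_face_prism_simplex_upper:
  assumes "j < k" "k \<le> q"
  shows "singular_face (Suc q) (Suc k) (prism_simplex q H j \<sigma>)
       = prism_simplex (q - 1) H j (singular_face q k \<sigma>)"
  using assms
  by (auto simp: singular_face_def prism_simplex_def fun_eq_iff collapse_simplical_face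
      tail_weight_simplical_face simplical_face_in_standard_simplex collapse_in_standard_simplex)

text \<open>\<open>D j k\<close> stands for the \<open>k\<close>-th face of the \<open>j\<close>-th prism simplex over \<open>\<sigma>\<close>, and \<open>E j k\<close> for the
  \<open>j\<close>-th prism simplex over the \<open>k\<close>-th face of \<open>\<sigma>\<close>.\<close>

lemma alternating_prism_sum:
  fixes D E :: "nat \<Rightarrow> nat \<Rightarrow> 'a \<Rightarrow>\<^sub>0 int" and T :: "nat \<Rightarrow> 'a \<Rightarrow>\<^sub>0 int"
  assumes lower: "\<And>j k. \<lbrakk>k \<le> j; j < q\<rbrakk> \<Longrightarrow> D (Suc j) k = E j k"
    and diag: "\<And>j. j \<le> q \<Longrightarrow> D j j = T j" "\<And>j. j \<le> q \<Longrightarrow> D j (Suc j) = T (Suc j)"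
    and upper: "\<And>j k. \<lbrakk>j < k; k \<le> q\<rbrakk> \<Longrightarrow> D j (Suc k) = E j k"
  shows "(\<Sum>j\<le>q. \<Sum>k\<le>Suc q. frag_cmul ((-1) ^ (j + k)) (D j k))
       = T 0 - T (Suc q) - (\<Sum>j<q. \<Sum>k\<le>q. frag_cmul ((-1) ^ (j + k)) (E j k))"
proof -
  let ?s = "\<lambda>n c. frag_cmul ((-1) ^ n) c :: 'a \<Rightarrow>\<^sub>0 int"
  have flip: "?s (Suc n) c = - ?s n c" for n c
  proof -
    have "?s (Suc n) c = frag_cmul (-1) (?s n c)"
      by (simp only: frag_cmul_cmul power_Suc)
    then show ?thesis
      by (simp only: frag_cmul_minus_one)
  qed
  \<comment> \<open>For fixed \<open>j\<close> the faces split into those below, on and above the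
    diagonal. Upper faces are reindexed by \<open>Suc k\<close>, which costs a sign; the two walls
    have opposite signs.\<close>
  have split: "(\<Sum>k\<le>Suc q. ?s (j + k) (D j k))
      = (\<Sum>k<j. ?s (j + k) (D j k)) + (T j - T (Suc j)) - (\<Sum>k=Suc j..q. ?s (j + k) (E j k))"
    if "j \<le> q" for j
  proof -
    have upper_sum: "(\<Sum>k=Suc j..q. ?s (j + k) (D j (Suc k))) = (\<Sum>k=Suc j..q. ?s (j + k) (E j k))"
      by (intro sum.cong) (auto simp: upper)
    have "{..Suc q} = {..<j} \<union> {j, Suc j} \<union> Suc ` {Suc j..q}"
      using that by (auto simp: image_Suc_atLeastAtMost)
    then have "(\<Sum>k\<le>Suc q. ?s (j + k) (D j k))
        = sum (\<lambda>k. ?s (j + k) (D j k)) ({..<j} \<union> {j, Suc j} \<union> Suc ` {Suc j..q})"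
      by simp
    also have "\<dots> = (\<Sum>k<j. ?s (j + k) (D j k)) + (T j - T (Suc j))
                  + (\<Sum>k=Suc j..q. ?s (j + Suc k) (D j (Suc k)))"
    proof -
      have "({..<j} \<union> {j, Suc j}) \<inter> Suc ` {Suc j..q} = {}" "{..<j} \<inter> {j, Suc j} = {}"
        by auto
      moreover have "(\<Sum>k\<in>{j, Suc j}. ?s (j + k) (D j k)) = T j - T (Suc j)"
        using that by (simp add: diag)
      ultimately show ?thesis
        by (simp add: sum.union_disjoint sum.reindex del: image_Suc_atLeastAtMost)
    qed
    finally show ?thesis
      by (simp only: add_Suc_right flip sum_negf diff_conv_add_uminus upper_sum)
  qed
  \<comment> \<open>The inner sum is empty for \<open>j = 0\<close>, so \<open>j\<close> can be
    replaced by \<open>Suc j\<close>; this shift produces the sign.\<close>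
  have low: "(\<Sum>j\<le>q. \<Sum>k<j. ?s (j + k) (D j k)) = - (\<Sum>j<q. \<Sum>k\<le>j. ?s (j + k) (E j k))"
  proof -
    have "(\<Sum>j\<le>q. \<Sum>k<j. ?s (j + k) (D j k)) = (\<Sum>j<q. \<Sum>k<Suc j. ?s (Suc j + k) (D (Suc j) k))"
      by (simp only: sum.atMost_shift) simp
    also have "\<dots> = (\<Sum>j<q. \<Sum>k\<le>j. - ?s (j + k) (E j k))"
      by (intro sum.cong refl) (simp_all only: lower lessThan_iff lessThan_Suc_atMost atMost_iff add_Suc flip)
    finally show ?thesis
      by (simp only: sum_negf)
  qed
  have up: "(\<Sum>j\<le>q. \<Sum>k=Suc j..q. ?s (j + k) (E j k)) = (\<Sum>j<q. \<Sum>k=Suc j..q. ?s (j + k) (E j k))"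
    by (simp flip: lessThan_Suc_atMost)
  \<comment> \<open>The inner walls cancel in pairs and only the two ends of the prism
    survive.\<close>
  have tele: "(\<Sum>j\<le>q. T j - T (Suc j)) = T 0 - T (Suc q)"
    by (simp add: sum_telescope)
  \<comment> \<open>The lower part has \<open>k \<le> j\<close> and the upper part
    \<open>k > j\<close>, so together they fill the whole rectangle of indices.\<close>
  have "(\<Sum>j<q. \<Sum>k\<le>q. ?s (j + k) (E j k))
      = (\<Sum>j<q. (\<Sum>k\<le>j. ?s (j + k) (E j k)) + (\<Sum>k=Suc j..q. ?s (j + k) (E j k)))"
  proof (rule sum.cong)
    fix j assume "j \<in> {..<q}"
    then have eq: "{..q} = {..j} \<union> {Suc j..q}" by auto
    have disjoint: "{..j} \<inter> {Suc j..q} = {}" by auto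
    show "(\<Sum>k\<le>q. ?s (j + k) (E j k))
        = (\<Sum>k\<le>j. ?s (j + k) (E j k)) + (\<Sum>k=Suc j..q. ?s (j + k) (E j k))"
      unfolding eq by (intro sum.union_disjoint disjoint) simp_all
  qed simp
  moreover have "(\<Sum>j\<le>q. \<Sum>k\<le>Suc q. ?s (j + k) (D j k))
      = (\<Sum>j\<le>q. (\<Sum>k<j. ?s (j + k) (D j k)) + (T j - T (Suc j))
               - (\<Sum>k=Suc j..q. ?s (j + k) (E j k)))"
    by (intro sum.cong split) auto
  ultimately show ?thesis
    by (simp only: sum.distrib sum_subtractf low up tele[unfolded sum_subtractf])
       (simp add: algebra_simps del: sum.atMost_Suc)
qed

lemma chain_boundary_prism_of:
  assumes "singular_simplex q X \<sigma>"
    and f: "\<And>x. x \<in> topspace X \<Longrightarrow> H (x, 0) = f x"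
    and g: "\<And>x. x \<in> topspace X \<Longrightarrow> H (x, 1) = g x"
  shows "chain_boundary (Suc q) (prism q H (frag_of \<sigma>))
       = chain_map q g (frag_of \<sigma>) - chain_map q f (frag_of \<sigma>)
         - prism (q - 1) H (chain_boundary q (frag_of \<sigma>))"
proof -
  \<comment> \<open>\<open>T m\<close> is the m-th wall. Its height is constantly 1 for
    \<open>m = 0\<close> and constantly 0 for \<open>m = Suc q\<close>, so the outermost walls are
    the pushforwards along \<open>g\<close> and \<open>f\<close>.\<close>
  define T where "T m = frag_of (restrict (\<lambda>x. H (\<sigma> x, tail_weight m x)) (standard_simplex q))" for m
  define D where "D j k = frag_of (singular_face (Suc q) k (prism_simplex q H j \<sigma>))" for j k
  define E where "E j k = frag_of (prism_simplex (q - 1) H j (singular_face q k \<sigma>))" for j k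
  have \<sigma>: "\<sigma> x \<in> topspace X" if "x \<in> standard_simplex q" for x
    using assms(1) that by (auto simp: singular_simplex_def continuous_map_def Pi_iff)
  have "T 0 = chain_map q g (frag_of \<sigma>)"
    using \<sigma> g by (auto simp: T_def simplex_map_def fun_eq_iff intro!: arg_cong[of _ _ frag_of])
  moreover have "T (Suc q) = chain_map q f (frag_of \<sigma>)"
    using \<sigma> f
    by (auto simp: T_def simplex_map_def fun_eq_iff tail_weight_top intro!: arg_cong[of _ _ frag_of])
  moreover have "prism (q - 1) H (chain_boundary q (frag_of \<sigma>))
      = (\<Sum>j<q. \<Sum>k\<le>q. frag_cmul ((-1) ^ (j + k)) (E j k))"
  \<comment> \<open>For \<open>q = 0\<close> the boundary is zero and the range \<open>j < q\<close>
    is empty, so the truncated \<open>q - 1\<close> does no harm.\<close>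
  proof (cases q)
    case (Suc r)
    have "prism (q - 1) H (chain_boundary q (frag_of \<sigma>))
        = (\<Sum>k\<le>q. \<Sum>j\<le>r. frag_cmul ((-1) ^ (j + k)) (E j k))"
      by (simp add: Suc chain_boundary_of prism_sum prism_cmul prism_of E_def frag_cmul_sum power_add mult.commute
          del: sum.atMost_Suc)
    then show ?thesis
      by (subst sum.swap) (simp add: Suc lessThan_Suc_atMost del: sum.atMost_Suc sum.lessThan_Suc)
  qed (simp add: chain_boundary_def)
  moreover have "chain_boundary (Suc q) (prism q H (frag_of \<sigma>))
      = (\<Sum>j\<le>q. \<Sum>k\<le>Suc q. frag_cmul ((-1) ^ (j + k)) (D j k))"
    by (simp add: prism_of chain_boundary_sum chain_boundary_cmul chain_boundary_of D_def
        frag_cmul_sum power_add o_def del: sum.atMost_Suc)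
  moreover have "\<dots> = T 0 - T (Suc q) - (\<Sum>j<q. \<Sum>k\<le>q. frag_cmul ((-1) ^ (j + k)) (E j k))"
    by (rule alternating_prism_sum)
       (simp_all add: D_def E_def T_def singular_face_prism_simplex_lower
         singular_face_prism_simplex_diagonal singular_face_prism_simplex_upper)
  ultimately show ?thesis
    by simp
qed

text \<open>Both sides are additive in \<open>c\<close>, so the formula for single simplices
  suffices. It exhibits \<open>prism\<close> as a chain homotopy from the pushforward along
  \<open>f\<close> to the one along \<open>g\<close>.\<close>

lemma chain_boundary_prism:
  assumes c: "singular_chain q X c"
    and f: "\<And>x. x \<in> topspace X \<Longrightarrow> H (x, 0) = f x"
    and g: "\<And>x. x \<in> topspace X \<Longrightarrow> H (x, 1) = g x"
  shows "chain_boundary (Suc q) (prism q H c)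
       = chain_map q g c - chain_map q f c - prism (q - 1) H (chain_boundary q c)"
  using c unfolding singular_chain_def
proof (induction c rule: frag_induction)
  case (one \<sigma>)
  then show ?case
    using chain_boundary_prism_of[of q X \<sigma> H f g] f g by simp
next
  case (diff a b)
  then show ?case
    by (simp add: chain_boundary_diff chain_map_diff prism_diff)
qed simp

section \<open>Continuity of the prism simplices\<close>

lemma continuous_map_collapse:
  "continuous_map (powertop_real UNIV) (powertop_real UNIV) (collapse j)"
  unfolding continuous_map_componentwise_UNIV collapse_def
  by (auto intro!: continuous_map_add continuous_map_product_projection)

lemma continuous_map_tail_weight:
  "continuous_map (powertop_real UNIV) euclideanreal (tail_weight m)"
  unfolding tail_weight_def[abs_def]
  by (intro continuous_map_diff continuous_map_sum continuous_map_product_projection) auto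

lemma singular_simplex_prism_simplex:
  assumes \<sigma>: "singular_simplex q X \<sigma>" and "j \<le> q"
    and H: "continuous_map (prod_topology X (top_of_set {0..1})) Y H"
  shows "singular_simplex (Suc q) Y (prism_simplex q H j \<sigma>)"
proof -
  let ?S = "\<lambda>q. subtopology (powertop_real UNIV) (standard_simplex q)"
  have "continuous_map (?S (Suc q)) (?S q) (collapse j)"
    using \<open>j \<le> q\<close> continuous_map_collapse collapse_in_standard_simplex
    by (auto simp: continuous_map_in_subtopology intro: continuous_map_from_subtopology)
  moreover have "continuous_map (?S q) X \<sigma>"
    using \<sigma> by (simp add: singular_simplex_def)
  ultimately have 1: "continuous_map (?S (Suc q)) X (\<lambda>x. \<sigma> (collapse j x))"
    using continuous_map_compose by (fastforce simp: o_def)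
  have 2: "continuous_map (?S (Suc q)) (top_of_set {0..1}) (tail_weight (Suc j))"
    using \<open>j \<le> q\<close> continuous_map_tail_weight tail_weight_in_unit_interval[of _ "Suc q" "Suc j"]
    by (auto simp: continuous_map_in_subtopology intro: continuous_map_from_subtopology)
  have "continuous_map (?S (Suc q)) (prod_topology X (top_of_set {0..1}))
          (\<lambda>x. (\<sigma> (collapse j x), tail_weight (Suc j) x))"
    using 1 2 by (simp add: continuous_map_pairedI)
  from continuous_map_compose[OF this H] show ?thesis
    by (auto simp: singular_simplex_def prism_simplex_def o_def
        intro: continuous_map_eq)
qed

section \<open>Allowable chains\<close>

text \<open>A face pulls back under a degeneracy to a face with at most one more vertex, the extra
  one arising when the doubled vertex \<open>j\<close> belongs to it.\<close>

lemma simplex_skeleton_collapse: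
  assumes x: "x \<in> standard_simplex (Suc q)" and "j \<le> q"
    and c: "collapse j x \<in> simplex_skeleton q m"
  shows "x \<in> simplex_skeleton (Suc q) (m + 1)"
proof -
  obtain V where V: "V \<subseteq> {..q}" "V \<noteq> {}" "int (card V) - 1 \<le> m"
    and z: "\<And>i. i \<notin> V \<Longrightarrow> collapse j x i = 0"
    using c by (auto simp: simplex_skeleton_def)
  \<comment> \<open>\<open>W\<close> is the preimage of \<open>V\<close> under the vertex map of
    \<open>collapse j\<close>; the index \<open>j\<close> occurs in both pieces because it has the
    two preimages \<open>j\<close> and \<open>Suc j\<close>.\<close>
  define W where "W = (V \<inter> {..j}) \<union> Suc ` (V \<inter> {j..})"
  have fin: "finite V" using V(1) finite_subset by blast
  have "card W \<le> card (V \<inter> {..j}) + card (V \<inter> {j..})"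
    unfolding W_def
    by (metis card_Un_le card_image inj_Suc inj_on_subset top_greatest)
  also have "\<dots> = card V + card (V \<inter> {j})"
  proof -
    have "(V \<inter> {..j}) \<union> (V \<inter> {j..}) = V" "(V \<inter> {..j}) \<inter> (V \<inter> {j..}) = V \<inter> {j}" by auto
    then show ?thesis
      using card_Un_Int[of "V \<inter> {..j}" "V \<inter> {j..}"] fin by simp
  qed
  also have "\<dots> \<le> Suc (card V)"
    using card_mono[of "{j}" "V \<inter> {j}"] by simp
  finally have "int (card W) - 1 \<le> m + 1"
    using V(3) by simp
  moreover have "W \<subseteq> {..Suc q}" "W \<noteq> {}"
    using V(1,2) by (auto simp: W_def) (metis Int_iff atLeast_iff atMost_iff empty_iff nle_le subset_empty subsetI)
  \<comment> \<open>Coordinates are nonnegative, so a vanishing merged coordinate forces both of its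
    summands to vanish.\<close>
  moreover have "x i = 0" if "i \<notin> W" for i
  proof -
    have x0: "x i \<ge> 0" for i
      using x by (simp add: standard_simplex_def)
    show ?thesis
    proof (cases "i \<le> j")
      case True
      then have "i \<notin> V" using that by (auto simp: W_def)
      then have "collapse j x i = 0" by (rule z)
      then show ?thesis
        using True x0[of i] x0[of "Suc i"] by (auto simp: collapse_def split: if_splits)
    next
      case False
      then obtain l where l: "i = Suc l" "j \<le> l" by (cases i) auto
      then have "l \<notin> V" using that by (auto simp: W_def)
      then have "collapse j x l = 0" by (rule z)
      then show ?thesis
        using l x0[of l] x0[of "Suc l"] by (auto simp: collapse_def split: if_splits)
    qed
  qed
  ultimately show ?thesis
    using x unfolding simplex_skeleton_def by blast
qed

section \<open>Strata and maps that preserve their index\<close>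

lemma stratum_subset_topspace:
  assumes "filtered_space X" "j \<in> {0..int (fdim X)}"
  shows "stratum X j \<subseteq> topspace (ftop X)"
  using assms closedin_subset[of "ftop X" "filt X j"]
  by (auto simp: filtered_space_def stratum_def)

lemma filt_mono:
  assumes "filtered_space X" "-1 \<le> i" "i \<le> j" "j \<le> int (fdim X)"
  shows "filt X i \<subseteq> filt X j"
  using assms(3,4)
proof (induction j rule: int_ge_induct)
  case (step j)
  have "filt X (j + 1 - 1) \<subseteq> filt X (j + 1)"
  proof -
    have "j + 1 \<in> {0..int (fdim X)}" using assms(2) step by auto
    then show ?thesis using assms(1) unfolding filtered_space_def by blast
  qed
  then show ?case using step by auto
qed simp

text \<open>For \<open>a < b\<close>, monotonicity puts stratum \<open>a\<close> inside
  \<open>filt X (b - 1)\<close>, which is removed in forming stratum \<open>b\<close>.\<close>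

lemma stratum_unique:
  assumes "filtered_space X" "i \<in> {0..int (fdim X)}" "j \<in> {0..int (fdim X)}"
    and "x \<in> stratum X i" "x \<in> stratum X j"
  shows "i = j"
proof -
  have False if "a < b" "a \<in> {0..int (fdim X)}" "b \<in> {0..int (fdim X)}"
      "x \<in> stratum X a" "x \<in> stratum X b" for a b
    using filt_mono[OF assms(1), of a "b - 1"] that by (auto simp: stratum_def)
  then show ?thesis
    using assms(2-5) by (meson linorder_neqE)
qed

lemma stratum_exists:
  assumes "filtered_space X" "x \<in> topspace (ftop X)"
  obtains j where "j \<in> {0..int (fdim X)}" "x \<in> stratum X j"
proof -
  \<comment> \<open>Descent through the filtration: a point either lies in the level below or in the
    difference, and the level at -1 is empty.\<close>
  have "x \<in> filt X (int m) \<Longrightarrow> m \<le> fdim X \<Longrightarrow> \<exists>j \<in> {0..int (fdim X)}. x \<in> stratum X j" for m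
  proof (induction m)
    case 0
    then show ?case
      using assms(1) by (intro bexI[of _ 0]) (auto simp: stratum_def filtered_space_def)
  next
    case (Suc m)
    then show ?case
      by (cases "x \<in> filt X (int m)") (auto simp: stratum_def intro!: bexI[of _ "int (Suc m)"])
  qed
  then show ?thesis
    using assms that by (metis filtered_space_def order_refl)
qed

text \<open>This is the condition imposed on \<open>f\<close> and \<open>g\<close>, and the one that
  the homotopies will be shown to satisfy. Equal dimension makes equal index mean equal
  codimension.\<close>

definition strict_stratum_preserving :: "'a filtered \<Rightarrow> 'b filtered \<Rightarrow> ('a \<Rightarrow> 'b) \<Rightarrow> bool" where
  "strict_stratum_preserving X Y f \<longleftrightarrow>
     filtered_space X \<and> filtered_space Y \<and> fdim X = fdim Y \<and>
     continuous_map (ftop X) (ftop Y) f \<and>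
     (\<forall>j \<in> {0..int (fdim X)}. f ` stratum X j \<subseteq> stratum Y j)"

text \<open>Strata cover the source and are disjoint in the target, so the inclusions of images
  become inclusions of preimages, the form in which allowability is stated.\<close>

lemma strict_stratum_preserving_vimage:
  assumes "strict_stratum_preserving X Y f" "x \<in> topspace (ftop X)"
    and "j \<in> {0..int (fdim Y)}" "f x \<in> stratum Y j"
  shows "x \<in> stratum X j"
proof -
  obtain l where "l \<in> {0..int (fdim X)}" "x \<in> stratum X l"
    using stratum_exists assms(1,2) unfolding strict_stratum_preserving_def by metis
  moreover have "f x \<in> stratum Y l"
    using calculation assms(1) unfolding strict_stratum_preserving_def by blast
  ultimately show ?thesis
    using assms stratum_unique[of Y l j "f x"] by (auto simp: strict_stratum_preserving_def)
qed

lemma allowable_simplex_map: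
  assumes f: "strict_stratum_preserving X Y f" and \<sigma>: "allowable_simplex p X q \<sigma>"
  shows "allowable_simplex p Y q (simplex_map q f \<sigma>)"
proof -
  have s: "singular_simplex q (ftop X) \<sigma>"
    using \<sigma> by (simp add: allowable_simplex_def)
  have top: "\<sigma> x \<in> topspace (ftop X)" if "x \<in> standard_simplex q" for x
    using s that by (auto simp: singular_simplex_def continuous_map_def Pi_iff)
  have dim: "fdim X = fdim Y" and cont: "continuous_map (ftop X) (ftop Y) f"
    using f by (auto simp: strict_stratum_preserving_def)
  have "x \<in> simplex_skeleton q (int q - int k + p k)"
    if "k \<le> fdim Y" "x \<in> standard_simplex q" "f (\<sigma> x) \<in> stratum Y (int (fdim Y) - int k)" for k x
    using strict_stratum_preserving_vimage[OF f top[OF that(2)] _ that(3)] that(1,2) \<sigma> dim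
    by (auto simp: allowable_simplex_def)
  then show ?thesis
    using singular_simplex_simplex_map[OF s cont]
    by (auto simp: allowable_simplex_def simplex_map_def)
qed

lemma chain_map_IC:
  assumes f: "strict_stratum_preserving X Y f" and c: "c \<in> IC p X q"
  shows "chain_map q f c \<in> IC p Y q"
proof -
  \<comment> \<open>General in degree and chain, since it is applied both to \<open>c\<close> and to
    its boundary, which commutes with pushforward.\<close>
  have keys: "Poly_Mapping.keys (chain_map r f d) \<subseteq> Collect (allowable_simplex p Y r)"
    if "Poly_Mapping.keys d \<subseteq> Collect (allowable_simplex p X r)" for r d
    using keys_frag_extend[of "frag_of \<circ> simplex_map r f" d] that allowable_simplex_map[OF f]
    unfolding chain_map_def by fastforce
  then show ?thesis
    using c chain_boundary_chain_map[OF IC_singular_chain[OF c], of f]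
    by (auto simp: IC_def)
qed

section \<open>Prisms over allowable chains\<close>

lemma stratum_filtered_cylinder: "stratum (filtered_cylinder X) j = stratum X j \<times> {0..1}"
  by (auto simp: stratum_def filtered_cylinder_def)

lemma filtered_space_filtered_cylinder:
  "filtered_space X \<Longrightarrow> filtered_space (filtered_cylinder X)"
  by (auto simp: filtered_space_def filtered_cylinder_def closedin_prod_Times_iff)

lemma allowable_prism_simplex:
  assumes H: "strict_stratum_preserving (filtered_cylinder X) Y H"
    and \<sigma>: "allowable_simplex p X q \<sigma>" and "j \<le> q"
  shows "allowable_simplex p Y (Suc q) (prism_simplex q H j \<sigma>)"
proof -
  have s: "singular_simplex q (ftop X) \<sigma>"
    using \<sigma> by (simp add: allowable_simplex_def)
  have top: "\<sigma> x \<in> topspace (ftop X)" if "x \<in> standard_simplex q" for x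
    using s that by (auto simp: singular_simplex_def continuous_map_def Pi_iff)
  have dim: "fdim X = fdim Y"
    and cont: "continuous_map (prod_topology (ftop X) (top_of_set {0..1})) (ftop Y) H"
    using H by (auto simp: strict_stratum_preserving_def filtered_cylinder_def)
  have "x \<in> simplex_skeleton (Suc q) (int (Suc q) - int k + p k)"
    if k: "k \<le> fdim Y" and x: "x \<in> standard_simplex (Suc q)"
      and st: "H (\<sigma> (collapse j x), tail_weight (Suc j) x) \<in> stratum Y (int (fdim Y) - int k)" for k x
  proof -
    have c: "collapse j x \<in> standard_simplex q"
      using x \<open>j \<le> q\<close> by (rule collapse_in_standard_simplex)
    have "(\<sigma> (collapse j x), tail_weight (Suc j) x) \<in> topspace (ftop (filtered_cylinder X))"
      using top[OF c] tail_weight_in_unit_interval[OF x, of "Suc j"] \<open>j \<le> q\<close>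
      by (simp add: filtered_cylinder_def)
    from strict_stratum_preserving_vimage[OF H this _ st]
    have "\<sigma> (collapse j x) \<in> stratum X (int (fdim X) - int k)"
      using k dim by (simp add: stratum_filtered_cylinder)
    then have "collapse j x \<in> simplex_skeleton q (int q - int k + p k)"
      using \<sigma> c k dim by (auto simp: allowable_simplex_def)
    \<comment> \<open>The dimension gained by the skeleton is exactly the difference between
      \<open>int q\<close> and \<open>int (Suc q)\<close> in the allowability bound.\<close>
    from simplex_skeleton_collapse[OF x \<open>j \<le> q\<close> this] show ?thesis
      by (simp add: algebra_simps)
  qed
  then show ?thesis
    using singular_simplex_prism_simplex[OF s \<open>j \<le> q\<close> cont]
    by (auto simp: allowable_simplex_def prism_simplex_def)
qed

lemma prism_IC:
  assumes H: "strict_stratum_preserving (filtered_cylinder X) Y H"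
    and f: "strict_stratum_preserving X Y f" "\<And>x. x \<in> topspace (ftop X) \<Longrightarrow> H (x, 0) = f x"
    and g: "strict_stratum_preserving X Y g" "\<And>x. x \<in> topspace (ftop X) \<Longrightarrow> H (x, 1) = g x"
    and c: "c \<in> IC p X q"
  shows "prism q H c \<in> IC p Y (Suc q)"
proof -
  have keys: "Poly_Mapping.keys (prism r H d) \<subseteq> Collect (allowable_simplex p Y (Suc r))"
    if "Poly_Mapping.keys d \<subseteq> Collect (allowable_simplex p X r)" for r d
    using keys_prism[of r H d] that allowable_prism_simplex[OF H] by blast
  \<comment> \<open>For \<open>q = 0\<close> the operator \<open>prism (q - 1)\<close> would land in
    degree 1 instead of \<open>q\<close>, but it is applied to the zero chain.\<close>
  have "Poly_Mapping.keys (prism (q - 1) H (chain_boundary q c)) \<subseteq> Collect (allowable_simplex p Y q)"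
  proof (cases q)
    case 0
    then show ?thesis by (simp add: chain_boundary_def)
  next
    case (Suc r)
    then show ?thesis using c keys[of "chain_boundary q c" r] by (simp add: IC_def)
  qed
  moreover have "Poly_Mapping.keys (chain_map q f c) \<subseteq> Collect (allowable_simplex p Y q)"
    "Poly_Mapping.keys (chain_map q g c) \<subseteq> Collect (allowable_simplex p Y q)"
    using chain_map_IC[OF f(1) c] chain_map_IC[OF g(1) c] by (auto simp: IC_def)
  moreover have "chain_boundary (Suc q) (prism q H c)
      = chain_map q g c - chain_map q f c - prism (q - 1) H (chain_boundary q c)"
    using chain_boundary_prism[OF IC_singular_chain[OF c]] f(2) g(2) by blast
  ultimately have "Poly_Mapping.keys (chain_boundary (Suc q) (prism q H c))
      \<subseteq> Collect (allowable_simplex p Y q)"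
    by (simp only:) (intro order_trans[OF keys_diff] Un_least)
  then show ?thesis
    using c keys by (simp add: IC_def)
qed

section \<open>Induced maps on intersection homology\<close>

lemma mult_IC_cycle_group [simp]: "x \<otimes>\<^bsub>IC_cycle_group p X i\<^esub> y = x + y"
  by (simp add: IC_cycle_group_def subgroup_generated_def)

lemma r_coset_IC_boundaries:
  "IC_boundaries p X i #>\<^bsub>IC_cycle_group p X i\<^esub> z = (\<lambda>b. b + z) ` IC_boundaries p X i"
  by (auto simp: r_coset_def)

lemma group_IC_cycle_group: "group (IC_cycle_group p X i)"
  unfolding IC_cycle_group_def by (intro group.group_subgroup_generated group_chain_group)

lemma carrier_IH:
  "carrier (IH p X i) = (\<lambda>z. IC_boundaries p X i #>\<^bsub>IC_cycle_group p X i\<^esub> z) ` IC_cycles p X i"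
  by (auto simp: IH_def FactGroup_def RCOSETS_def carrier_IC_cycle_group)

lemma IC_boundaries_coset_eqI:
  assumes "z - w \<in> IC_boundaries p X i" "z \<in> IC_cycles p X i" "w \<in> IC_cycles p X i"
  shows "IC_boundaries p X i #>\<^bsub>IC_cycle_group p X i\<^esub> z
       = IC_boundaries p X i #>\<^bsub>IC_cycle_group p X i\<^esub> w"
proof (rule group.repr_independence[OF group_IC_cycle_group, symmetric])
  show "z \<in> IC_boundaries p X i #>\<^bsub>IC_cycle_group p X i\<^esub> w"
    using assms(1) by (force simp: r_coset_IC_boundaries)
  show "w \<in> carrier (IC_cycle_group p X i)"
    using assms(3) by (simp add: carrier_IC_cycle_group)
  show "subgroup (IC_boundaries p X i) (IC_cycle_group p X i)"
    using normal_IC_boundaries normal_imp_subgroup by blast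
qed

lemma IC_cycles_add:
  "\<lbrakk>a \<in> IC_cycles p X i; b \<in> IC_cycles p X i\<rbrakk> \<Longrightarrow> a + b \<in> IC_cycles p X i"
  using group.is_monoid[OF group_IC_cycle_group, THEN monoid.m_closed, of a p X i b]
  by (simp add: carrier_IC_cycle_group)

lemma mult_IH_coset:
  assumes "a \<in> IC_cycles p X i" "b \<in> IC_cycles p X i"
  shows "(IC_boundaries p X i #>\<^bsub>IC_cycle_group p X i\<^esub> a) \<otimes>\<^bsub>IH p X i\<^esub>
         (IC_boundaries p X i #>\<^bsub>IC_cycle_group p X i\<^esub> b)
       = IC_boundaries p X i #>\<^bsub>IC_cycle_group p X i\<^esub> (a + b)"
  using normal.rcos_sum[OF normal_IC_boundaries, of a p X i b] assms
  by (simp add: IH_def FactGroup_def carrier_IC_cycle_group)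

lemma IC_cycles_chain_map:
  assumes "strict_stratum_preserving X Y f" "z \<in> IC_cycles p X i"
  shows "chain_map i f z \<in> IC_cycles p Y i"
  using assms chain_map_IC[OF assms(1)] chain_boundary_chain_map[of i "ftop X" z f]
  by (auto simp: IC_cycles_def dest: IC_singular_chain)

text \<open>The filling chain is pushed forward as well and stays allowable, so the bounding
  relation persists within the allowable complex.\<close>

lemma IC_boundaries_chain_map:
  assumes "strict_stratum_preserving X Y f" "b \<in> IC_boundaries p X i"
  shows "chain_map i f b \<in> IC_boundaries p Y i"
proof -
  obtain d where d: "d \<in> IC p X (Suc i)" "b = chain_boundary (Suc i) d"
    using assms(2) by (auto simp: IC_boundaries_def)
  have "chain_map i f b = chain_boundary (Suc i) (chain_map (Suc i) f d)"
    using chain_boundary_chain_map[OF IC_singular_chain[OF d(1)], of f] d(2) by simp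
  then show ?thesis
    using chain_map_IC[OF assms(1) d(1)] by (auto simp: IC_boundaries_def)
qed

text \<open>Representatives differ by allowable boundaries, which \<open>f\<close> sends to
  allowable boundaries. Thus the set inside \<open>the_elem\<close> is a singleton.\<close>

lemma IH_induced_coset:
  assumes f: "strict_stratum_preserving X Y f" and z: "z \<in> IC_cycles p X i"
  shows "IH_induced p X Y i f (IC_boundaries p X i #>\<^bsub>IC_cycle_group p X i\<^esub> z)
       = IC_boundaries p Y i #>\<^bsub>IC_cycle_group p Y i\<^esub> chain_map i f z"
proof -
  \<comment> \<open>Makes the coset nonempty, so that its image is a singleton and not the empty
    set.\<close>
  have 0: "0 \<in> IC_boundaries p X i"
    unfolding IC_boundaries_def using zero_in_IC[of p X "Suc i"]
    by (intro image_eqI[of _ _ 0]) auto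
  have "IC_boundaries p Y i #>\<^bsub>IC_cycle_group p Y i\<^esub> chain_map i f (b + z)
      = IC_boundaries p Y i #>\<^bsub>IC_cycle_group p Y i\<^esub> chain_map i f z"
    if b: "b \<in> IC_boundaries p X i" for b
  proof (rule IC_boundaries_coset_eqI)
    show "chain_map i f (b + z) - chain_map i f z \<in> IC_boundaries p Y i"
      using IC_boundaries_chain_map[OF f that] by (simp add: chain_map_add)
    have "b + z \<in> IC_cycles p X i"
      using b z IC_boundaries_subset[of p X i] by (intro IC_cycles_add) auto
    then show "chain_map i f (b + z) \<in> IC_cycles p Y i" "chain_map i f z \<in> IC_cycles p Y i"
      using IC_cycles_chain_map[OF f] z by auto
  qed
  then have "(\<lambda>z. IC_boundaries p Y i #>\<^bsub>IC_cycle_group p Y i\<^esub> chain_map i f z)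
        ` ((\<lambda>b. b + z) ` IC_boundaries p X i)
      = {IC_boundaries p Y i #>\<^bsub>IC_cycle_group p Y i\<^esub> chain_map i f z}"
    using 0 by (force simp: image_image)
  then show ?thesis
    unfolding IH_induced_def r_coset_IC_boundaries[of p X i] by simp
qed

lemma IH_induced_hom:
  assumes f: "strict_stratum_preserving X Y f"
  shows "IH_induced p X Y i f \<in> hom (IH p X i) (IH p Y i)"
proof (rule homI)
  fix C assume "C \<in> carrier (IH p X i)"
  then show "IH_induced p X Y i f C \<in> carrier (IH p Y i)"
    using IC_cycles_chain_map[OF f] by (auto simp: carrier_IH IH_induced_coset[OF f])
next
  fix C D assume "C \<in> carrier (IH p X i)" "D \<in> carrier (IH p X i)"
  then obtain z w where z: "z \<in> IC_cycles p X i" "w \<in> IC_cycles p X i"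
    and CD: "C = IC_boundaries p X i #>\<^bsub>IC_cycle_group p X i\<^esub> z"
      "D = IC_boundaries p X i #>\<^bsub>IC_cycle_group p X i\<^esub> w"
    by (auto simp: carrier_IH)
  show "IH_induced p X Y i f (C \<otimes>\<^bsub>IH p X i\<^esub> D)
      = IH_induced p X Y i f C \<otimes>\<^bsub>IH p Y i\<^esub> IH_induced p X Y i f D"
    using z
    by (simp add: CD mult_IH_coset IH_induced_coset[OF f] IC_cycles_add IC_cycles_chain_map[OF f]
        chain_map_add)
qed

text \<open>The prism over a representing cycle is an allowable chain that bounds the difference
  between the cycle and its image under the composite.\<close>

lemma IH_induced_inverse:
  assumes f: "strict_stratum_preserving X Y f" and g: "strict_stratum_preserving Y X g"
    and H: "strict_stratum_preserving (filtered_cylinder X) X H"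
    and H01: "\<And>x. x \<in> topspace (ftop X) \<Longrightarrow> H (x, 0) = g (f x)"
      "\<And>x. x \<in> topspace (ftop X) \<Longrightarrow> H (x, 1) = x"
    and C: "C \<in> carrier (IH p X i)"
  shows "IH_induced p Y X i g (IH_induced p X Y i f C) = C"
proof -
  obtain z where z: "z \<in> IC_cycles p X i"
    and C: "C = IC_boundaries p X i #>\<^bsub>IC_cycle_group p X i\<^esub> z"
    using C by (auto simp: carrier_IH)
  have chain: "singular_chain i (ftop X) z" and IC: "z \<in> IC p X i" and cycle: "chain_boundary i z = 0"
    using z IC_singular_chain by (auto simp: IC_cycles_def)
  have gfz: "chain_map i g (chain_map i f z) \<in> IC_cycles p X i"
    by (intro IC_cycles_chain_map[OF g] IC_cycles_chain_map[OF f] z)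
  have gf: "strict_stratum_preserving X X (g \<circ> f)"
    using f g continuous_map_compose[of "ftop X" "ftop Y" f "ftop X" g]
    unfolding strict_stratum_preserving_def by (auto simp: image_subset_iff)
  have id: "strict_stratum_preserving X X id"
    using f by (simp add: strict_stratum_preserving_def)
  \<comment> \<open>The term with the prism of the boundary drops out because \<open>z\<close> is a
    cycle.\<close>
  have "chain_boundary (Suc i) (prism i H z) = z - chain_map i g (chain_map i f z)"
    using chain_boundary_prism[OF chain, of H "g \<circ> f" id] H01 cycle chain
    by (simp add: chain_map_compose chain_map_ident)
  moreover have "prism i H z \<in> IC p X (Suc i)"
    using H01 by (intro prism_IC[OF H gf _ id _ IC]) auto
  ultimately have "z - chain_map i g (chain_map i f z) \<in> IC_boundaries p X i"
    unfolding IC_boundaries_def by (metis imageI)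
  from IC_boundaries_coset_eqI[OF this z gfz, symmetric] show ?thesis
    by (simp add: C IH_induced_coset[OF f z] IH_induced_coset[OF g IC_cycles_chain_map[OF f z]])
qed

text \<open>\<open>H\<close> and \<open>K\<close> each settle one composite, so the map induced by
  \<open>g\<close> is a two-sided inverse.\<close>

lemma IH_induced_iso:
  assumes f: "strict_stratum_preserving X Y f" and g: "strict_stratum_preserving Y X g"
    and H: "strict_stratum_preserving (filtered_cylinder X) X H"
      "\<And>x. x \<in> topspace (ftop X) \<Longrightarrow> H (x, 0) = g (f x)"
      "\<And>x. x \<in> topspace (ftop X) \<Longrightarrow> H (x, 1) = x"
    and K: "strict_stratum_preserving (filtered_cylinder Y) Y K"
      "\<And>y. y \<in> topspace (ftop Y) \<Longrightarrow> K (y, 0) = f (g y)"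
      "\<And>y. y \<in> topspace (ftop Y) \<Longrightarrow> K (y, 1) = y"
  shows "IH_induced p X Y i f \<in> iso (IH p X i) (IH p Y i)"
proof (rule isoI)
  show "bij_betw (IH_induced p X Y i f) (carrier (IH p X i)) (carrier (IH p Y i))"
    using IH_induced_hom[OF f, of p i] IH_induced_hom[OF g, of p i]
      IH_induced_inverse[OF f g H] IH_induced_inverse[OF g f K]
    by (intro bij_betwI[where g = "IH_induced p Y X i g"]) (auto simp: hom_def)
qed (rule IH_induced_hom[OF f])

text \<open>A stratum-preserving map may send a component to a stratum of any index; being the
  identity at time 1 pins that index down along the homotopy.\<close>

lemma stratum_preserving_homotopic_idD:
  assumes X: "filtered_space X" and "stratum_preserving_homotopic X X h id"
  obtains H where "strict_stratum_preserving (filtered_cylinder X) X H"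
    "\<And>x. x \<in> topspace (ftop X) \<Longrightarrow> H (x, 0) = h x"
    "\<And>x. x \<in> topspace (ftop X) \<Longrightarrow> H (x, 1) = x"
proof -
  obtain H where H: "stratum_preserving (filtered_cylinder X) X H"
    and H01: "\<And>x. x \<in> topspace (ftop X) \<Longrightarrow> H (x, 0) = h x"
      "\<And>x. x \<in> topspace (ftop X) \<Longrightarrow> H (x, 1) = x"
    using assms(2) by (auto simp: stratum_preserving_homotopic_def)
  have dim: "fdim (filtered_cylinder X) = fdim X"
    by (simp add: filtered_cylinder_def)
  have "H (x, t) \<in> stratum X j"
    if j: "j \<in> {0..int (fdim X)}" and x: "x \<in> stratum X j" and t: "t \<in> {0..1}" for j x t
  proof -
    let ?S = "subtopology (ftop (filtered_cylinder X)) (stratum (filtered_cylinder X) j)"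
    let ?C = "connected_component_of_set ?S (x, 1)"
    have xX: "x \<in> topspace (ftop X)"
      using stratum_subset_topspace[OF X j] x by blast
    \<comment> \<open>The segment over \<open>x\<close> stays inside one stratum of the cylinder, so
      \<open>(x, t)\<close> lies in the component \<open>?C\<close> of
      \<open>(x, 1)\<close>.\<close>
    have "connectedin ?S ({x} \<times> {0..1})"
      using x xX unfolding connectedin_subtopology stratum_filtered_cylinder
      by (auto simp: filtered_cylinder_def connectedin_Times connectedin_subtopology)
    then have "connected_component_of ?S (x, 1) (x, t)" and x1: "connected_component_of ?S (x, 1) (x, 1)"
      using t by (auto simp: connected_component_of_def intro!: exI[of _ "{x} \<times> {0..1}"])
    moreover have "?C \<in> connected_components_of ?S"
      using x1 by (metis connected_component_in_connected_components_of connected_component_of_refl)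
    then obtain l where l: "l \<in> {0..int (fdim X)}" and "H ` ?C \<subseteq> stratum X l"
      using H j unfolding stratum_preserving_def dim by blast
    ultimately have "H (x, t) \<in> stratum X l" and l1: "H (x, 1) \<in> stratum X l"
      using x1 by auto
    \<comment> \<open>At time 1 the value is \<open>x\<close>, which lies in stratum
      \<open>j\<close>; disjointness of strata gives \<open>l = j\<close>.\<close>
    then show ?thesis
      using stratum_unique[OF X l j l1] x H01(2)[OF xX] by simp
  qed
  then have "strict_stratum_preserving (filtered_cylinder X) X H"
    using H X filtered_space_filtered_cylinder[OF X] dim
    by (auto simp: strict_stratum_preserving_def stratum_preserving_def stratum_filtered_cylinder)
  then show ?thesis
    using that H01 by blast
qed

theorem proposition2p1:
  fixes X :: "'a filtered" and Y :: "'b filtered"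
    and n i :: nat and p :: "nat \<Rightarrow> int"
    and f :: "'a \<Rightarrow> 'b" and g :: "'b \<Rightarrow> 'a"
  assumes "filtered_space X" and "filtered_space Y"
    and "fdim X = n" and "fdim Y = n"
    and "perversity p"
    and "stratum_preserving_homotopy_equivalence X Y f g"
    and "\<And>j. j \<in> {0..int n} \<Longrightarrow> f ` stratum X j \<subseteq> stratum Y j"
    and "\<And>j. j \<in> {0..int n} \<Longrightarrow> g ` stratum Y j \<subseteq> stratum X j"
  shows "chain_map i f ` IC p X i \<subseteq> IC p Y i
    \<and> chain_map i g ` IC p Y i \<subseteq> IC p X i
    \<and> IH_induced p X Y i f \<in> iso (IH p X i) (IH p Y i)
    \<and> IH_induced p Y X i g \<in> iso (IH p Y i) (IH p X i)"
proof -
  have f: "strict_stratum_preserving X Y f" and g: "strict_stratum_preserving Y X g"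
    using assms
    by (auto simp: strict_stratum_preserving_def stratum_preserving_homotopy_equivalence_def
        stratum_preserving_def)
  obtain H where H: "strict_stratum_preserving (filtered_cylinder X) X H"
    "\<And>x. x \<in> topspace (ftop X) \<Longrightarrow> H (x, 0) = g (f x)"
    "\<And>x. x \<in> topspace (ftop X) \<Longrightarrow> H (x, 1) = x"
    using stratum_preserving_homotopic_idD[of X "g \<circ> f"] assms(1,6)
    by (auto simp: stratum_preserving_homotopy_equivalence_def)
  obtain K where K: "strict_stratum_preserving (filtered_cylinder Y) Y K"
    "\<And>y. y \<in> topspace (ftop Y) \<Longrightarrow> K (y, 0) = f (g y)"
    "\<And>y. y \<in> topspace (ftop Y) \<Longrightarrow> K (y, 1) = y"
    using stratum_preserving_homotopic_idD[of Y "f \<circ> g"] assms(2,6)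
    by (auto simp: stratum_preserving_homotopy_equivalence_def)
  \<comment> \<open>The hypotheses are symmetric, so exchanging the spaces together with
    \<open>H\<close> and \<open>K\<close> gives the statement for \<open>g\<close>.\<close>
  show ?thesis
    using chain_map_IC[OF f] chain_map_IC[OF g] IH_induced_iso[OF f g H K] IH_induced_iso[OF g f K H]
    by blast
qed

end
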